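(* The generating function $G^{\mathrm r}(x)=\sum_{n\ge0}g^{\mathrm r}_{n+1}\frac{x^n}{n!}$ satisfies $G^{\mathrm r}(x)=1+\int_0^xH(t)\,dt$, where \[ H(x)=\frac{2\sqrt\theta\,(4-\theta)(1+\xi^2)^2\Bigl[(1-\xi^2)\sqrt{4-\theta}\bigl(1-(1-\theta)e^{-\theta x}\bigr)+2\sqrt\theta\,\xi\bigl(1-(3-\theta)e^{-\theta x}\bigr)\Bigr]}{\bigl(\sqrt\theta\,\xi+\sqrt{4-\theta}\bigr)^3\bigl(\sqrt\theta-\sqrt{4-\theta}\,\xi\bigr)^3}, \] with $\xi=\tan\bigl(\sqrt{\theta(4-\theta)}\,x/4\bigr)$.
   Context: $\mathcal S_n$ is the set of permutations of $[n]$. For $\pi\in\mathcal S_n$ written in standard cycle form (each cycle begins with its smallest element, cycles ordered left to right by increasing smallest elements), $\mathrm{Flatten}(\pi)$ is the word obtained by erasing the parentheses. For a word $w$, $\mathrm r(w)$ is the number of indices $i$ with $w_i<w_{i+1}<w_{i+2}$ (occurrences of $123$-subwords). Let $g^{\mathrm r}_n=\sum_{\pi\in\mathcal S_n}q^{\mathrm r(\mathrm{Flatten}(\pi))}$, with $q$ an indeterminate and $\theta=1-q$. *)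

theory Defs
  imports
    "HOL-Combinatorics.Cycles"
    "HOL-Computational_Algebra.Computational_Algebra"
    "HOL-Algebra.Algebraic_Closure_Type"
begin

text \<open>
  The list \<open>support p i\<close> is the cycle \<open>i, p i, p (p i), \<dots>\<close> of \<open>p\<close> written from \<open>i\<close>
  on (a singleton for a fixed point). Keeping it only when \<open>i\<close> is its smallest entry, and letting
  \<open>i\<close> run through \<open>1, \<dots>, n\<close> in increasing order, lists every cycle of \<open>p\<close> exactly once,
  in the required order.
\<close>

definition standard_cycle_form :: "nat \<Rightarrow> (nat \<Rightarrow> nat) \<Rightarrow> nat list list" where
  "standard_cycle_form n p =
     map (support p) (filter (\<lambda>i. \<forall>j\<in>set (support p i). i \<le> j) [1..<n+1])"

definition flatten :: "nat \<Rightarrow> (nat \<Rightarrow> nat) \<Rightarrow> nat list" where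
  "flatten n p = concat (standard_cycle_form n p)"

definition num_123 :: "nat list \<Rightarrow> nat" where
  "num_123 w = card {i. i + 2 < length w \<and> w ! i < w ! (i+1) \<and> w ! (i+1) < w ! (i+2)}"

text \<open>The indeterminate \<open>q\<close> is the polynomial variable \<open>[:0, 1:]\<close>.\<close>

definition g_r :: "nat \<Rightarrow> int poly" where
  "g_r n = (\<Sum>p | p permutes {1..n}. [:0, 1:] ^ num_123 (flatten n p))"

text \<open>
  All power series in \<open>x\<close> have coefficients in the algebraic closure of \<open>Frac(\<int>[q]) = \<rat>(q)\<close>,
  which contains the square roots of \<open>\<theta>\<close> and \<open>4 - \<theta>\<close>.
\<close>

type_synonym K = "int poly fract alg_closure"

definition embed :: "int poly \<Rightarrow> K" where
  "embed f = to_ac (Fract f 1)"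

definition \<theta> :: K where
  "\<theta> = 1 - embed [:0, 1:]"

definition G_r :: "K fps" where
  "G_r = Abs_fps (\<lambda>n. embed (g_r (n + 1)) / fact n)"

text \<open>
  In the following, \<open>s\<close> and \<open>u\<close> stand for the square roots of \<open>\<theta>\<close> and \<open>4 - \<theta>\<close>. The series
  \<open>fps_tan c\<close> and \<open>fps_exp c\<close> are the expansions of \<open>tan (c x)\<close> and \<open>exp (c x)\<close>. The
  denominator of \<open>H_r\<close> has constant term \<open>(u s)\<^sup>3 \<noteq> 0\<close>, so it is an invertible power series.
\<close>

definition \<xi> :: "K \<Rightarrow> K \<Rightarrow> K fps" where
  "\<xi> s u = fps_tan (s * u / 4)"

definition H_r :: "K \<Rightarrow> K \<Rightarrow> K fps" where
  "H_r s u =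
     (let t = \<xi> s u; E = fps_exp (- \<theta>) in
      fps_const (2 * s * (4 - \<theta>)) * (1 + t\<^sup>2)\<^sup>2 *
        ((1 - t\<^sup>2) * fps_const u * (1 - fps_const (1 - \<theta>) * E)
          + fps_const (2 * s) * t * (1 - fps_const (3 - \<theta>) * E))
      / ((fps_const s * t + fps_const u) ^ 3 * (fps_const s - fps_const u * t) ^ 3))"

end

theory Submission
  imports Defs "HOL-Combinatorics.Multiset_Permutations"
begin

text \<open>
  Inserting \<open>n + 1\<close> into a cycle of a permutation of \<open>[n]\<close> inserts it behind some letter of the
  flattened word, and making it a fixed point appends it, so that appending arises twice. Hence
  \<open>1 w\<close> is flattened from \<open>2\<^sup>r\<close> permutations, where \<open>r\<close> counts the right-to-left minima of \<open>w\<close>.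
  Let \<open>B\<^sub>y\<close> be the exponential generating function of words \<open>w\<close> weighted by
  \<open>q\<^bsup>r(1w)\<^esup>\<close> and by \<open>y\<close> for each right-to-left minimum, so that \<open>G = B\<^sub>2\<close>. Splitting a word at its
  smallest letter gives \<open>B\<^sub>y' = y ((B\<^sub>1 - \<theta>) B\<^sub>y + \<theta>)\<close>: a Riccati equation for \<open>y = 1\<close>, and then a
  linear equation for \<open>y = 2\<close>. Both have explicit solutions in \<open>cos (s u x / 2)\<close>,
  \<open>sin (s u x / 2)\<close> and \<open>exp (-\<theta> x)\<close>, and \<open>\<xi>\<close> is the tangent of the half angle.
\<close>

subsection \<open>Words split at their smallest letter\<close>

lemma num_123_simps [simp]:
  "num_123 [] = 0" "num_123 [a] = 0" "num_123 [a, b] = 0"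
  "num_123 (a # b # c # w) = of_bool (a < b \<and> b < c) + num_123 (b # c # w)"
proof -
  let ?P = "\<lambda>w i. i + 2 < length w \<and> w ! i < w ! (i + 1) \<and> w ! (i + 1) < w ! (i + 2)"
  let ?w = "a # b # c # w"
  have fin: "finite {i. ?P w i}" for w :: "nat list"
    by (rule finite_subset[of _ "{..<length w}"]) auto
  have "{i. ?P ?w i} = {i. i = 0 \<and> a < b \<and> b < c} \<union> Suc ` {i. ?P (b # c # w) i}"
  proof (rule Set.set_eqI)
    fix i
    show "i \<in> {i. ?P ?w i} \<longleftrightarrow> i \<in> {i. i = 0 \<and> a < b \<and> b < c} \<union> Suc ` {i. ?P (b # c # w) i}"
      by (cases i) (auto simp: image_iff)
  qed
  then have "card {i. ?P ?w i} = card {i::nat. i = 0 \<and> a < b \<and> b < c} + card (Suc ` {i. ?P (b # c # w) i})"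
    using fin[of "b # c # w"] by (simp only:) (rule card_Un_disjoint, auto)
  then show "num_123 ?w = of_bool (a < b \<and> b < c) + num_123 (b # c # w)"
    unfolding num_123_def by (simp add: card_image of_bool_def)
qed (simp_all add: num_123_def)

text \<open>The value of \<open>num_123 (m # w)\<close> for any \<open>m\<close> below all letters
  of \<open>w\<close>. It depends on \<open>w\<close> alone, so words can be weighted as if preceded
  by 1 without carrying that letter along.\<close>

fun num_123_prefixed :: "nat list \<Rightarrow> nat" where
  "num_123_prefixed (a # b # w) = of_bool (a < b) + num_123 (a # b # w)"
| "num_123_prefixed w = 0"

lemma num_123_Cons_min:
  "\<forall>x\<in>set w. m < x \<Longrightarrow> num_123 (m # w) = num_123_prefixed w"
  by (cases w rule: num_123_prefixed.cases) auto

text \<open>A triple with \<open>m\<close> in second or third place has a larger letter before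
  \<open>m\<close>, so no increasing triple reaches across from \<open>v\<close>.\<close>

lemma num_123_append_min:
  "\<forall>x\<in>set v. m < x \<Longrightarrow> num_123 (v @ m # w) = num_123 v + num_123 (m # w)"
proof (induction v)
  case (Cons a v)
  then show ?case
    by (cases v rule: num_123_prefixed.cases; cases w) auto
qed simp

text \<open>The virtual prefix letter meets \<open>m\<close> directly only when \<open>v\<close> is
  empty. Prefix, \<open>m\<close> and the first letter of \<open>w\<close> then form the one extra
  increasing triple.\<close>

lemma num_123_prefixed_append_min:
  assumes "\<forall>x\<in>set v. m < x" "\<forall>x\<in>set w. m < x"
  shows "num_123_prefixed (v @ m # w) =
    num_123_prefixed v + num_123_prefixed w + of_bool (v = [] \<and> w \<noteq> [])"
proof (cases v rule: num_123_prefixed.cases)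
  case (1 a b v')
  then show ?thesis
    using num_123_append_min[OF assms(1), of w] num_123_Cons_min[OF assms(2)] by simp
next
  case "2_1"
  then show ?thesis
    using assms(2) num_123_Cons_min[OF assms(2)] by (cases w) auto
next
  case ("2_2" a)
  then show ?thesis
    using assms num_123_Cons_min[OF assms(2)] by (cases w) auto
qed

fun right_to_left_minima :: "nat list \<Rightarrow> nat" where
  "right_to_left_minima [] = 0"
| "right_to_left_minima (x # w) = of_bool (\<forall>y\<in>set w. x < y) + right_to_left_minima w"

text \<open>Every letter of \<open>v\<close> has the smaller \<open>m\<close> to its right, while
  \<open>m\<close> itself always counts.\<close>

lemma right_to_left_minima_append_min:
  "\<forall>x\<in>set v \<union> set w. m < x \<Longrightarrow>
    right_to_left_minima (v @ m # w) = Suc (right_to_left_minima w)"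
  by (induction v) auto

text \<open>A word on \<open>S\<close> amounts to the set \<open>T\<close> of letters before
  \<open>m\<close> together with an ordering of each side; \<open>takeWhile\<close> and
  \<open>dropWhile\<close> recover the two sides.\<close>

lemma sum_permutations_of_set_split:
  fixes h :: "'a list \<Rightarrow> 'b::comm_monoid_add"
  assumes "finite S" "m \<in> S"
  shows "(\<Sum>w\<in>permutations_of_set S. h w) =
    (\<Sum>T\<in>Pow (S - {m}). \<Sum>v\<in>permutations_of_set T. \<Sum>w\<in>permutations_of_set (S - {m} - T). h (v @ m # w))"
proof -
  let ?I = "SIGMA T:Pow (S - {m}). permutations_of_set T \<times> permutations_of_set (S - {m} - T)"
  have "(\<Sum>T\<in>Pow (S - {m}). \<Sum>v\<in>permutations_of_set T. \<Sum>w\<in>permutations_of_set (S - {m} - T). h (v @ m # w))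
      = (\<Sum>(T, v, w)\<in>?I. h (v @ m # w))"
    using assms(1) by (subst sum.Sigma[symmetric]) (auto simp: sum.cartesian_product)
  also have "\<dots> = (\<Sum>w\<in>permutations_of_set S. h w)"
  proof (rule sum.reindex_bij_witness)
    fix z assume "z \<in> ?I"
    then obtain T v w where z: "z = (T, v, w)" "T \<subseteq> S - {m}" "set v = T" "distinct v"
      "set w = S - {m} - T" "distinct w"
      by (auto simp: permutations_of_set_def)
    then show "(\<lambda>(T, v, w). v @ m # w) z \<in> permutations_of_set S"
      using assms by (auto simp: permutations_of_set_def)
    from z have "m \<notin> set v" by auto
    then have "takeWhile (\<lambda>x. x \<noteq> m) (v @ m # w) = v" "dropWhile (\<lambda>x. x \<noteq> m) (v @ m # w) = m # w"
      by (auto simp: takeWhile_append dropWhile_append)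
    then show "(\<lambda>w. (set (takeWhile (\<lambda>x. x \<noteq> m) w), takeWhile (\<lambda>x. x \<noteq> m) w,
        tl (dropWhile (\<lambda>x. x \<noteq> m) w))) ((\<lambda>(T, v, w). v @ m # w) z) = z"
      using z by simp
    show "h ((\<lambda>(T, v, w). v @ m # w) z) = (\<lambda>(T, v, w). h (v @ m # w)) z"
      by (simp add: z)
  next
    fix x assume "x \<in> permutations_of_set S"
    then have x: "set x = S" "distinct x"
      by (auto simp: permutations_of_set_def)
    then obtain v w where vw: "x = v @ m # w"
      using assms(2) by (metis in_set_conv_decomp)
    with x have m: "m \<notin> set v" by auto
    then have "takeWhile (\<lambda>x. x \<noteq> m) x = v" "dropWhile (\<lambda>x. x \<noteq> m) x = m # w"
      by (auto simp: takeWhile_append dropWhile_append vw)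
    moreover have "(set v, v, w) \<in> ?I"
      using x m by (auto simp: permutations_of_set_def vw)
    ultimately show "(\<lambda>(T, v, w). v @ m # w) (set (takeWhile (\<lambda>x. x \<noteq> m) x),
        takeWhile (\<lambda>x. x \<noteq> m) x, tl (dropWhile (\<lambda>x. x \<noteq> m) x)) = x"
      and "(set (takeWhile (\<lambda>x. x \<noteq> m) x), takeWhile (\<lambda>x. x \<noteq> m) x, tl (dropWhile (\<lambda>x. x \<noteq> m) x)) \<in> ?I"
      by (simp_all add: vw)
  qed
  finally show ?thesis ..
qed

lemma sum_Pow_card:
  fixes f :: "nat \<Rightarrow> 'a::comm_semiring_1"
  assumes "finite R"
  shows "(\<Sum>T\<in>Pow R. f (card T)) = (\<Sum>k\<le>card R. of_nat (card R choose k) * f k)"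
proof -
  have "(\<Sum>T\<in>Pow R. f (card T)) = (\<Sum>k\<le>card R. \<Sum>T | T \<in> Pow R \<and> card T = k. f (card T))"
    using assms by (intro sum.group[symmetric]) (auto intro: card_mono)
  also have "\<dots> = (\<Sum>k\<le>card R. of_nat (card R choose k) * f k)"
    using assms by (intro sum.cong) (simp_all add: n_subsets)
  finally show ?thesis .
qed

section \<open>Recursion and exponential generating function of the total weights\<close>

definition word_weight :: "'a::comm_ring_1 \<Rightarrow> 'a \<Rightarrow> nat list \<Rightarrow> 'a" where
  "word_weight q y w = q ^ num_123_prefixed w * y ^ right_to_left_minima w"

definition total_weight :: "'a::comm_ring_1 \<Rightarrow> 'a \<Rightarrow> nat set \<Rightarrow> 'a" where
  "total_weight q y S = (\<Sum>w\<in>permutations_of_set S. word_weight q y w)"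

lemma total_weight_empty [simp]: "total_weight q y {} = 1"
  by (simp add: total_weight_def word_weight_def)

text \<open>The factor \<open>y\<close> comes from \<open>m\<close>. The letters of \<open>T\<close>
  stand before \<open>m\<close> and are no right-to-left minima of the whole word, so their part is
  weighted with \<open>y = 1\<close>.\<close>

lemma total_weight_rec:
  fixes q y :: "'a::comm_ring_1"
  assumes "finite S" "m \<in> S" "\<forall>x\<in>S - {m}. m < x"
  defines "R \<equiv> S - {m}"
  shows "total_weight q y S = y * ((\<Sum>T\<in>Pow R. total_weight q 1 T * total_weight q y (R - T))
      + of_bool (R \<noteq> {}) * (q - 1) * total_weight q y R)"
proof -
  let ?c = "\<lambda>T. if T = {} \<and> R \<noteq> {} then q else 1"
  have "(\<Sum>v\<in>permutations_of_set T. \<Sum>w\<in>permutations_of_set (R - T). word_weight q y (v @ m # w))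
      = y * (?c T * (total_weight q 1 T * total_weight q y (R - T)))" if "T \<in> Pow R" for T
  proof -
    have "word_weight q y (v @ m # w) = y * ?c T * (word_weight q 1 v * word_weight q y w)"
      if "v \<in> permutations_of_set T" "w \<in> permutations_of_set (R - T)" for v w
    proof -
      have vw: "set v = T" "set w = R - T" using that by (auto simp: permutations_of_set_def)
      then have "\<forall>x\<in>set v. m < x" "\<forall>x\<in>set w. m < x" "\<forall>x\<in>set v \<union> set w. m < x"
        using assms(3) \<open>T \<in> Pow R\<close> by (auto simp: R_def)
      moreover have "v = [] \<and> w \<noteq> [] \<longleftrightarrow> T = {} \<and> R \<noteq> {}"
        using vw by auto
      ultimately show ?thesis
        by (simp add: word_weight_def num_123_prefixed_append_min right_to_left_minima_append_min power_add)
    qed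
    then have "(\<Sum>v\<in>permutations_of_set T. \<Sum>w\<in>permutations_of_set (R - T). word_weight q y (v @ m # w))
      = (\<Sum>v\<in>permutations_of_set T. \<Sum>w\<in>permutations_of_set (R - T).
          y * ?c T * (word_weight q 1 v * word_weight q y w))"
      by (intro sum.cong refl) auto
    also have "\<dots> = y * ?c T * (total_weight q 1 T * total_weight q y (R - T))"
      unfolding total_weight_def sum_product by (simp add: sum_distrib_left)
    finally show ?thesis by (simp add: mult.assoc)
  qed
  then have "total_weight q y S = y * (\<Sum>T\<in>Pow R. ?c T * (total_weight q 1 T * total_weight q y (R - T)))"
    unfolding total_weight_def[of q y S] sum_permutations_of_set_split[OF assms(1,2)] sum_distrib_left
    unfolding R_def[symmetric] by (intro sum.cong refl)
  \<comment> \<open>The extra triple gives a factor \<open>q\<close> for empty \<open>T\<close>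
    only. Writing \<open>q = 1 + (q - 1)\<close> leaves the full sum plus a single correction
    term.\<close>
  also have "(\<Sum>T\<in>Pow R. ?c T * (total_weight q 1 T * total_weight q y (R - T)))
    = (\<Sum>T\<in>Pow R. total_weight q 1 T * total_weight q y (R - T)
        + (if T = {} then of_bool (R \<noteq> {}) * (q - 1) * total_weight q y R else 0))"
    by (intro sum.cong) (auto simp: algebra_simps)
  also have "\<dots> = (\<Sum>T\<in>Pow R. total_weight q 1 T * total_weight q y (R - T))
      + of_bool (R \<noteq> {}) * (q - 1) * total_weight q y R"
    using assms(1) by (simp add: sum.distrib R_def)
  finally show ?thesis .
qed

abbreviation standard_weight :: "'a::comm_ring_1 \<Rightarrow> 'a \<Rightarrow> nat \<Rightarrow> 'a" where
  "standard_weight q y n \<equiv> total_weight q y {..<n}"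

text \<open>Independence of the weight from the underlying set is an assumption for smaller sets, so
  that the recursion can serve inside the induction proving this independence as well as after
  it.\<close>

lemma standard_weight_rec_aux:
  fixes q y :: "'a::comm_ring_1"
  assumes "finite S" "card S = Suc n"
    and IH: "\<And>T y. finite T \<Longrightarrow> card T \<le> n \<Longrightarrow> total_weight q y T = standard_weight q y (card T)"
  shows "total_weight q y S = y * ((\<Sum>k\<le>n. of_nat (n choose k) * (standard_weight q 1 k * standard_weight q y (n - k)))
      + of_bool (n \<noteq> 0) * (q - 1) * standard_weight q y n)"
proof -
  define m R where "m = Min S" "R = S - {m}"
  have "S \<noteq> {}" using assms(2) by auto
  then have m: "m \<in> S" "\<forall>x\<in>S - {m}. m < x"
    using assms(1) by (auto simp: m_R_def less_le)
  have R: "finite R" "card R = n"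
    using assms m by (auto simp: m_R_def)
  have "(\<Sum>T\<in>Pow R. total_weight q 1 T * total_weight q y (R - T))
      = (\<Sum>T\<in>Pow R. (\<lambda>k. standard_weight q 1 k * standard_weight q y (n - k)) (card T))"
  proof (intro sum.cong refl)
    fix T assume "T \<in> Pow R"
    then have "finite T" "card T \<le> n" "card (R - T) = n - card T"
      using R by (auto simp: card_mono card_Diff_subset finite_subset)
    then show "total_weight q 1 T * total_weight q y (R - T)
        = (\<lambda>k. standard_weight q 1 k * standard_weight q y (n - k)) (card T)"
      using IH[of T 1] IH[of "R - T" y] R by simp
  qed
  also have "\<dots> = (\<Sum>k\<le>n. of_nat (n choose k) * (standard_weight q 1 k * standard_weight q y (n - k)))"
    using sum_Pow_card[OF R(1), of "\<lambda>k. standard_weight q 1 k * standard_weight q y (n - k)"] R(2) by simp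
  finally have eq: "(\<Sum>T\<in>Pow R. total_weight q 1 T * total_weight q y (R - T)) = \<dots>" .
  have "R \<noteq> {} \<longleftrightarrow> n \<noteq> 0" using R by auto
  with eq show ?thesis
    unfolding total_weight_rec[OF assms(1) m] m_R_def(2)[symmetric] using IH[OF R(1)] R(2) by simp
qed

text \<open>Instead of relabelling letters, the recursion is used: \<open>S\<close> and
  \<open>{..<card S}\<close> satisfy the same one.\<close>

lemma total_weight_eq_standard_weight:
  "finite S \<Longrightarrow> total_weight q y S = standard_weight q y (card S)"
proof (induction "card S" arbitrary: S y rule: less_induct)
  case less
  show ?case
  proof (cases "card S")
    case (Suc n)
    have IH: "total_weight q y T = standard_weight q y (card T)" if "finite T" "card T \<le> n" for T y
      using less.hyps[of T y] that Suc by simp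
    have "standard_weight q y (Suc n) = y * ((\<Sum>k\<le>n. of_nat (n choose k) *
        (standard_weight q 1 k * standard_weight q y (n - k))) + of_bool (n \<noteq> 0) * (q - 1) * standard_weight q y n)"
      by (rule standard_weight_rec_aux[OF _ _ IH]) simp_all
    moreover have "total_weight q y S = y * ((\<Sum>k\<le>n. of_nat (n choose k) *
        (standard_weight q 1 k * standard_weight q y (n - k))) + of_bool (n \<noteq> 0) * (q - 1) * standard_weight q y n)"
      by (rule standard_weight_rec_aux[OF less.prems Suc IH])
    ultimately show ?thesis by (simp only: Suc)
  qed (use less in simp)
qed

lemma standard_weight_Suc:
  "standard_weight q y (Suc n) =
     y * ((\<Sum>k\<le>n. of_nat (n choose k) * (standard_weight q 1 k * standard_weight q y (n - k)))
      + of_bool (n \<noteq> 0) * (q - 1) * standard_weight q y n)"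
  by (rule standard_weight_rec_aux[OF _ _ total_weight_eq_standard_weight]) simp_all

definition weight_egf :: "'a::field_char_0 \<Rightarrow> 'a \<Rightarrow> 'a fps" where
  "weight_egf q y = Abs_fps (\<lambda>n. standard_weight q y n / fact n)"

lemma weight_egf_0 [simp]: "weight_egf q y $ 0 = 1"
  by (simp add: weight_egf_def)

text \<open>The binomial convolution is a product of series. The correction is absent for
  \<open>n = 0\<close>, so it contributes \<open>(q - 1) (B - 1)\<close> with
  \<open>B = weight_egf q y\<close>; this is the source of the inhomogeneous constant
  \<open>1 - q\<close>.\<close>

lemma weight_egf_deriv:
  fixes q y :: "'a::field_char_0"
  shows "fps_deriv (weight_egf q y) =
    fps_const y * ((weight_egf q 1 - fps_const (1 - q)) * weight_egf q y + fps_const (1 - q))"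
proof (rule fps_ext)
  fix n
  let ?b = "standard_weight q"
  have "(\<Sum>k\<le>n. of_nat (n choose k) * (?b 1 k * ?b y (n - k))) / fact n
      = (weight_egf q 1 * weight_egf q y) $ n"
    unfolding fps_mult_nth weight_egf_def sum_divide_distrib atMost_atLeast0
    by (intro sum.cong) (simp_all add: binomial_fact)
  moreover have "fps_deriv (weight_egf q y) $ n = ?b y (Suc n) / fact n"
    by (simp add: weight_egf_def del: of_nat_Suc)
  ultimately have *: "fps_deriv (weight_egf q y) $ n =
      y * ((weight_egf q 1 * weight_egf q y) $ n + of_bool (n \<noteq> 0) * (q - 1) * (?b y n / fact n))"
    unfolding standard_weight_Suc by (simp add: add_divide_distrib distrib_left flip: times_divide_eq_right)
  show "fps_deriv (weight_egf q y) $ n = (fps_const y * ((weight_egf q 1 - fps_const (1 - q))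
      * weight_egf q y + fps_const (1 - q))) $ n"
    unfolding * by (cases "n = 0") (simp_all add: algebra_simps diff_divide_distrib weight_egf_def)
qed

subsection \<open>Flattened permutations\<close>

text \<open>If \<open>p\<close> shifts \<open>cs\<close> cyclically, its powers run through
  \<open>cs\<close> from the head, and distinctness excludes a return before
  \<open>length cs\<close> steps. This characterises cycles without computing
  \<open>least_power\<close>.\<close>

lemma support_eqI:
  assumes "distinct cs" "cs \<noteq> []" "map p cs = rotate1 cs"
  shows "support p (hd cs) = cs"
proof -
  let ?l = "length cs"
  have l: "0 < ?l" using assms(2) by simp
  have step: "p (cs ! k) = cs ! (Suc k mod ?l)" if "k < ?l" for k
    using that assms(3) by (metis nth_map nth_rotate1)
  have pow: "(p ^^ k) (hd cs) = cs ! (k mod ?l)" for k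
  proof (induction k)
    case (Suc k)
    then show ?case using step[of "k mod ?l"] l by (simp add: mod_Suc_eq)
  qed (use assms(2) in \<open>simp add: hd_conv_nth\<close>)
  have "least_power p (hd cs) = ?l"
    unfolding least_power_def
  proof (rule Least_equality)
    show "(p ^^ ?l) (hd cs) = hd cs \<and> 0 < ?l"
      using pow[of ?l] l assms(2) by (simp add: hd_conv_nth)
  next
    fix k assume k: "(p ^^ k) (hd cs) = hd cs \<and> 0 < k"
    show "?l \<le> k"
    proof (rule ccontr)
      assume "\<not> ?l \<le> k"
      then show False
        using k assms(1,2) nth_eq_iff_index_eq[of cs k 0] pow[of k] by (simp add: hd_conv_nth)
    qed
  qed
  then show ?thesis
    by (intro nth_equalityI) (simp_all add: pow)
qed

lemma support_nonempty:
  "permutation p \<Longrightarrow> support p i \<noteq> [] \<and> hd (support p i) = i"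
  using least_power_of_permutation(2)[of p i] by (simp add: hd_map)

lemma map_support:
  assumes "permutation p"
  shows "map p (support p i) = rotate1 (support p i)"
proof (rule nth_equalityI)
  let ?l = "least_power p i"
  fix k assume "k < length (map p (support p i))"
  then have k: "k < ?l" by simp
  have "(p ^^ Suc k) i = (p ^^ (Suc k mod ?l)) i"
    using k least_power_of_permutation[OF assms, of i] by (cases "Suc k = ?l") auto
  then show "map p (support p i) ! k = rotate1 (support p i) ! k"
    using k by (simp add: nth_rotate1)
qed simp

text \<open>Defined letterwise so that it commutes with concatenation unconditionally, hence can be
  applied cycle by cycle. It is used for words in which \<open>j\<close> occurs at most
  once.\<close>

definition insert_after :: "'a \<Rightarrow> 'a \<Rightarrow> 'a list \<Rightarrow> 'a list" where
  "insert_after j x w = concat (map (\<lambda>y. if y = j then [j, x] else [y]) w)"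

lemma insert_after_append: "insert_after j x (v @ w) = insert_after j x v @ insert_after j x w"
  by (simp add: insert_after_def)

lemma insert_after_notin: "j \<notin> set w \<Longrightarrow> insert_after j x w = w"
  by (induction w) (auto simp: insert_after_def)

lemma insert_after_concat: "insert_after j x (concat ws) = concat (map (insert_after j x) ws)"
  by (induction ws) (simp_all add: insert_after_append, simp add: insert_after_def)

lemma insert_after_decomp:
  "j \<notin> set v \<Longrightarrow> j \<notin> set w \<Longrightarrow> insert_after j x (v @ j # w) = v @ j # x # w"
  by (simp add: insert_after_append insert_after_notin insert_after_def[of j x "j # w"])
     (simp add: insert_after_def[symmetric] insert_after_notin)

lemma set_insert_after: "set (insert_after j x w) = set w \<union> (if j \<in> set w then {x} else {})"
  by (induction w) (auto simp: insert_after_def)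

text \<open>The composed permutation sends \<open>j\<close> to \<open>x\<close> and \<open>x\<close>
  to \<open>p j\<close> and agrees with \<open>p\<close> elsewhere. So \<open>x\<close> slips in
  between \<open>j\<close> and \<open>p j\<close>, and cycles avoiding \<open>j\<close> stay as they
  are.\<close>

lemma support_transpose_comp:
  assumes p: "permutation p" "p x = x" and "j \<noteq> x" "i \<noteq> x"
  shows "support (transpose x (p j) \<circ> p) i = insert_after j x (support p i)"
proof -
  let ?p = "transpose x (p j) \<circ> p" and ?c = "support p i"
  have c: "distinct ?c" "map p ?c = rotate1 ?c" "?c \<noteq> []" "hd ?c = i"
    using cycle_of_permutation[OF p(1)] map_support[OF p(1)] support_nonempty[OF p(1)] by blast+
  have inj: "inj p" using p(1) by (simp add: bij_is_inj permutation_bijective)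
  then have "(p ^^ k) i \<noteq> x" for k
    using assms(4) p(2) by (induction k) (auto simp: inj_eq[OF inj, of _ x, unfolded p(2)])
  then have x: "x \<notin> set ?c" by auto
  have other: "?p y = p y" if "y \<noteq> j" "y \<noteq> x" for y
    using that inj p(2) by (metis comp_apply inj_eq transpose_apply_other)
  have pj: "?p j = x" "?p x = p j"
    using p(2) by simp_all
  have "distinct (insert_after j x ?c) \<and> insert_after j x ?c \<noteq> [] \<and> hd (insert_after j x ?c) = i
      \<and> map ?p (insert_after j x ?c) = rotate1 (insert_after j x ?c)"
  proof (cases "j \<in> set ?c")
    case False
    then have "\<forall>y\<in>set ?c. ?p y = p y"
      using x by (intro ballI other) auto
    then have m: "map ?p ?c = map p ?c" by (intro map_cong refl) blast
    show ?thesis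
      unfolding insert_after_notin[OF False] m by (intro conjI c)
  next
    case True
    then obtain v w where vw: "?c = v @ j # w" by (metis in_set_conv_decomp)
    with c(1) have j: "j \<notin> set v" "j \<notin> set w" by auto
    have eq: "insert_after j x ?c = v @ j # x # w"
      unfolding vw using j by (rule insert_after_decomp)
    have "map ?p v = map p v" "map ?p w = map p w"
      using j x vw by (auto intro!: map_cong other simp del: comp_apply)
    then have m: "map ?p (v @ j # x # w) = map p v @ x # p j # map p w"
      using pj by simp
    have r: "map p v @ p j # map p w = rotate1 (v @ j # w)"
      using c(2) unfolding vw by simp
    have "map p v @ x # p j # map p w = rotate1 (v @ j # x # w)"
    \<comment> \<open>Rotation moves the first letter to the end. It is \<open>j\<close> itself if
      \<open>v\<close> is empty; otherwise the two sides of the rotated old cycle are separated by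
      comparing lengths.\<close>
    proof (cases v)
      case Nil
      then show ?thesis using r by simp
    next
      case (Cons a v')
      then have "map p v @ p j # map p w = (v' @ [j]) @ (w @ [a])" using r by simp
      then have "map p v = v' @ [j]" "p j # map p w = w @ [a]"
        using Cons by (subst (asm) append_eq_append_conv; simp)+
      then show ?thesis using Cons by simp
    qed
    then have "map ?p (insert_after j x ?c) = rotate1 (insert_after j x ?c)"
      unfolding eq m .
    moreover have "distinct (v @ j # x # w)" "hd (v @ j # x # w) = i"
      using c(1,4) x unfolding vw by (cases v; auto)+
    ultimately show ?thesis
      unfolding eq by simp
  qed
  then show ?thesis using support_eqI by metis
qed

text \<open>Adding the largest letter \<open>Suc n\<close> to a cycle changes no cycle minimum. The
  cycle through \<open>Suc n\<close> also contains \<open>p j\<close>, which is at most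
  \<open>n\<close>, so \<open>Suc n\<close> opens no cycle and the order of the cycles is
  kept.\<close>

lemma flatten_insert:
  assumes p: "p permutes {1..n}" and j: "j \<in> {1..n}"
  shows "flatten (Suc n) (transpose (Suc n) (p j) \<circ> p) = insert_after j (Suc n) (flatten n p)"
proof -
  let ?N = "Suc n" and ?p = "transpose (Suc n) (p j) \<circ> p"
  have perm: "permutation p" using p by (auto simp: permutation_permutes)
  have pN: "p ?N = ?N" using p by (auto simp: permutes_not_in)
  have pj: "p j \<in> {1..n}" using permutes_in_image[OF p] j by simp
  have sup: "support ?p i = insert_after j ?N (support p i)" if "i \<in> {1..n}" for i
    by (rule support_transpose_comp) (use perm pN j that in auto)
  have "permutation ?p"
    using perm by (simp add: permutation_compose permutation_swap_id)
  then have "set (support ?p ?N) = range (\<lambda>k. (?p ^^ k) ?N)"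
    by (rule support_set)
  then have "(?p ^^ 1) ?N \<in> set (support ?p ?N)"
    by (simp only:) (rule rangeI)
  moreover have "(?p ^^ 1) ?N = p j"
    by (simp add: pN)
  ultimately have mem: "p j \<in> set (support ?p ?N)"
    by (simp only:)
  have last: "\<not> (\<forall>k\<in>set (support ?p ?N). ?N \<le> k)"
  proof
    assume "\<forall>k\<in>set (support ?p ?N). ?N \<le> k"
    then have "?N \<le> p j" using mem by (rule bspec)
    then show False using pj by simp
  qed
  have min: "(\<forall>k\<in>set (support ?p i). i \<le> k) \<longleftrightarrow> (\<forall>k\<in>set (support p i). i \<le> k)"
    if "i \<in> {1..n}" for i
    unfolding sup[OF that] set_insert_after using that by auto
  have "standard_cycle_form ?N ?p =
      map (support ?p) (filter (\<lambda>i. \<forall>k\<in>set (support ?p i). i \<le> k) [1..<n+1])"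
    using last by (simp add: standard_cycle_form_def del: set_map)
  also have "\<dots> = map (support ?p) (filter (\<lambda>i. \<forall>k\<in>set (support p i). i \<le> k) [1..<n+1])"
    by (intro arg_cong[of _ _ "map _"] filter_cong refl min) auto
  also have "\<dots> = map (insert_after j ?N) (standard_cycle_form n p)"
    unfolding standard_cycle_form_def map_map o_def[of "insert_after j ?N"]
    by (intro map_cong refl sup) auto
  finally show ?thesis
    by (simp add: flatten_def insert_after_concat)
qed

lemma flatten_append_fixpoint:
  assumes p: "p permutes {1..n}"
  shows "flatten (Suc n) p = flatten n p @ [Suc n]"
proof -
  have "p (Suc n) = Suc n" using p by (auto simp: permutes_not_in)
  then have "support p (hd [Suc n]) = [Suc n]"
    by (intro support_eqI) auto
  then show ?thesis
    by (simp add: flatten_def standard_cycle_form_def del: set_map)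
qed

text \<open>Each permutation of \<open>{1..Suc n}\<close> is uniquely
  \<open>transpose (Suc n) b \<circ> p\<close> with \<open>p\<close> permuting
  \<open>{1..n}\<close>; the value \<open>b = Suc n\<close> makes \<open>Suc n\<close> a fixed
  point.\<close>

lemma sum_permutes_Suc_flatten:
  fixes f :: "nat list \<Rightarrow> 'a::comm_monoid_add"
  shows "(\<Sum>p | p permutes {1..Suc n}. f (flatten (Suc n) p)) =
    (\<Sum>p | p permutes {1..n}. f (flatten n p @ [Suc n]) + (\<Sum>j\<in>{1..n}. f (insert_after j (Suc n) (flatten n p))))"
proof -
  have "(\<Sum>p | p permutes {1..Suc n}. f (flatten (Suc n) p)) =
      (\<Sum>b\<in>insert (Suc n) {1..n}. \<Sum>p | p permutes {1..n}. f (flatten (Suc n) (transpose (Suc n) b \<circ> p)))"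
    by (subst sum_over_permutations_insert[symmetric]) (simp_all add: atLeastAtMostSuc_conv)
  also have "\<dots> = (\<Sum>p | p permutes {1..n}. f (flatten (Suc n) p)
      + (\<Sum>b\<in>{1..n}. f (flatten (Suc n) (transpose (Suc n) b \<circ> p))))"
    by (subst sum.swap) simp
  also have "\<dots> = (\<Sum>p | p permutes {1..n}. f (flatten n p @ [Suc n])
      + (\<Sum>j\<in>{1..n}. f (insert_after j (Suc n) (flatten n p))))"
  proof (rule sum.cong)
    fix p assume "p \<in> {p. p permutes {1..n}}"
    then have p: "p permutes {1..n}" by simp
    \<comment> \<open>Substituting \<open>b = p j\<close> names the letter \<open>j\<close> behind
      which \<open>Suc n\<close> is inserted.\<close>
    have "(\<Sum>b\<in>{1..n}. f (flatten (Suc n) (transpose (Suc n) b \<circ> p)))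
        = (\<Sum>j\<in>{1..n}. f (flatten (Suc n) (transpose (Suc n) (p j) \<circ> p)))"
      using permutes_imp_bij[OF p] by (rule sum.reindex_bij_betw[symmetric])
    also have "\<dots> = (\<Sum>j\<in>{1..n}. f (insert_after j (Suc n) (flatten n p)))"
      by (rule sum.cong) (simp_all add: flatten_insert[OF p])
    finally show "f (flatten (Suc n) p) + (\<Sum>b\<in>{1..n}. f (flatten (Suc n) (transpose (Suc n) b \<circ> p)))
        = f (flatten n p @ [Suc n]) + (\<Sum>j\<in>{1..n}. f (insert_after j (Suc n) (flatten n p)))"
      by (simp only: flatten_append_fixpoint[OF p])
  qed simp
  finally show ?thesis .
qed

section \<open>From flattened permutations to weighted words\<close>

lemma right_to_left_minima_insert_max:
  "\<forall>y\<in>set v \<union> set w. y < x \<Longrightarrow>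
    right_to_left_minima (v @ x # w) = right_to_left_minima (v @ w) + of_bool (w = [])"
proof (induction v)
  case Nil
  then show ?case by (cases w) auto
qed auto

lemma sum_permutations_of_set_insert:
  fixes h :: "'a list \<Rightarrow> 'b::comm_monoid_add"
  assumes "finite S" "x \<notin> S"
  shows "(\<Sum>w\<in>permutations_of_set (insert x S). h w) =
    (\<Sum>w\<in>permutations_of_set S. \<Sum>k\<le>card S. h (take k w @ x # drop k w))"
proof -
  have "(\<Sum>w\<in>permutations_of_set S. \<Sum>k\<le>card S. h (take k w @ x # drop k w))
      = (\<Sum>(w, k)\<in>permutations_of_set S \<times> {..card S}. h (take k w @ x # drop k w))"
    by (rule sum.cartesian_product)
  also have "\<dots> = (\<Sum>w\<in>permutations_of_set (insert x S). h w)"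
  proof (rule sum.reindex_bij_witness)
    fix z assume "z \<in> permutations_of_set S \<times> {..card S}"
    then obtain w k where z: "z = (w, k)" "set w = S" "distinct w" "k \<le> length w"
      by (auto simp: permutations_of_set_def distinct_card)
    define a b where "a = take k w" "b = drop k w"
    have w: "w = a @ b" "k = length a" using z by (simp_all add: a_b_def)
    then show "(\<lambda>(w, k). take k w @ x # drop k w) z \<in> permutations_of_set (insert x S)"
      using z assms by (auto simp: permutations_of_set_def)
    have "x \<notin> set a" using w z assms(2) by auto
    then have "remove1 x (a @ x # b) = a @ b" "takeWhile (\<lambda>y. y \<noteq> x) (a @ x # b) = a"
      by (auto simp: remove1_append takeWhile_append)
    then show "(\<lambda>w. (remove1 x w, length (takeWhile (\<lambda>y. y \<noteq> x) w)))
        ((\<lambda>(w, k). take k w @ x # drop k w) z) = z"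
      using z w by simp
    show "h ((\<lambda>(w, k). take k w @ x # drop k w) z) = (\<lambda>(w, k). h (take k w @ x # drop k w)) z"
      by (simp add: z)
  next
    fix w assume "w \<in> permutations_of_set (insert x S)"
    then have w: "set w = insert x S" "distinct w"
      by (auto simp: permutations_of_set_def)
    then obtain a b where ab: "w = a @ x # b"
      by (metis in_set_conv_decomp insertI1)
    with w have x: "x \<notin> set a" "x \<notin> set b" by auto
    then have *: "remove1 x w = a @ b" "takeWhile (\<lambda>y. y \<noteq> x) w = a"
      by (auto simp: remove1_append takeWhile_append ab)
    have ab_set: "set (a @ b) = S" using w x assms(2) by (auto simp: ab)
    moreover have "distinct (a @ b)" using w(2) by (simp add: ab)
    moreover from this have "card S = length a + length b"
      using distinct_card[of "a @ b"] ab_set by simp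
    ultimately show "(remove1 x w, length (takeWhile (\<lambda>y. y \<noteq> x) w)) \<in> permutations_of_set S \<times> {..card S}"
      unfolding * by (auto simp: permutations_of_set_def)
    show "(\<lambda>(w, k). take k w @ x # drop k w) (remove1 x w, length (takeWhile (\<lambda>y. y \<noteq> x) w)) = w"
      unfolding * by (simp add: ab)
  qed
  finally show ?thesis ..
qed

text \<open>Induction by inserting the largest letter. Only the final gap is reached twice, as a
  fixed point and behind the last letter, and only there does the new letter become a right-to-left
  minimum, which accounts for the factor 2.\<close>

lemma sum_flatten_eq_sum_words:
  fixes f :: "nat list \<Rightarrow> 'a::comm_ring_1"
  shows "(\<Sum>p | p permutes {1..Suc n}. f (flatten (Suc n) p)) =
    (\<Sum>w\<in>permutations_of_set {2..Suc n}. 2 ^ right_to_left_minima w * f (1 # w))"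
proof (induction n arbitrary: f)
  case 0
  have "flatten 0 id = []"
    by (simp add: flatten_def standard_cycle_form_def)
  then have "flatten (Suc 0) id = [Suc 0]"
    using flatten_append_fixpoint[of id 0] by simp
  then show ?case
    by (simp add: id_def)
next
  case (Suc n)
  let ?N = "Suc (Suc n)" and ?m = right_to_left_minima
  have S: "{2..?N} = insert ?N {2..Suc n}" by auto
  \<comment> \<open>The induction hypothesis is applied to the sum of \<open>f\<close> over all
    insertions of \<open>?N\<close>, which is why \<open>f\<close> must be arbitrary.\<close>
  have "(\<Sum>p | p permutes {1..?N}. f (flatten ?N p)) =
      (\<Sum>w\<in>permutations_of_set {2..Suc n}. 2 ^ ?m w *
         (f (1 # w @ [?N]) + (\<Sum>j\<in>{1..Suc n}. f (insert_after j ?N (1 # w)))))"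
    unfolding sum_permutes_Suc_flatten by (subst Suc.IH) simp
  also have "\<dots> = (\<Sum>w\<in>permutations_of_set {2..Suc n}. \<Sum>k\<le>card {2..Suc n}.
      2 ^ ?m (take k w @ ?N # drop k w) * f (1 # take k w @ ?N # drop k w))"
  proof (intro sum.cong refl)
    fix w assume "w \<in> permutations_of_set {2..Suc n}"
    then have w: "set w = {2..Suc n}" "distinct w"
      by (auto simp: permutations_of_set_def)
    then have len: "length w = n" using distinct_card[OF w(2)] by simp
    have min: "?m (take k w @ ?N # drop k w) = ?m w + of_bool (k = n)" if "k \<le> n" for k
    proof -
      have "\<forall>y\<in>set (take k w) \<union> set (drop k w). y < ?N"
        using w(1) by (auto dest!: in_set_takeD in_set_dropD)
      then show ?thesis
        using that by (simp add: right_to_left_minima_insert_max len)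
    qed
    \<comment> \<open>Letters are replaced by their positions: inserting behind position
      \<open>k\<close> of \<open>1 # w\<close> means inserting at gap \<open>k\<close> of
      \<open>w\<close>, because of the leading 1.\<close>
    have "bij_betw ((!) (1 # w)) {..<length (1 # w)} {1..Suc n}"
      by (rule bij_betw_nth) (use w in auto)
    then have "(\<Sum>j\<in>{1..Suc n}. f (insert_after j ?N (1 # w)))
        = (\<Sum>k\<in>{..<length (1 # w)}. f (insert_after ((1 # w) ! k) ?N (1 # w)))"
      by (rule sum.reindex_bij_betw[symmetric])
    also have "\<dots> = (\<Sum>k\<le>n. f (1 # take k w @ ?N # drop k w))"
    proof (intro sum.cong)
      fix k assume "k \<in> {..n}"
      then have k: "k < length (1 # w)" using len by simp
      define a b where "a = take k (1 # w)" "b = drop k w"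
      have d: "1 # w = a @ (1 # w) ! k # b"
        unfolding a_b_def using id_take_nth_drop[OF k] by simp
      have "distinct (1 # w)" using w by auto
      then have "insert_after ((1 # w) ! k) ?N (1 # w) = a @ (1 # w) ! k # ?N # b"
        by (subst (2) d, intro insert_after_decomp) (use d in \<open>metis distinct.simps(2) distinct_append not_distinct_conv_prefix\<close>)+
      also have "a @ (1 # w) ! k # ?N # b = take (Suc k) (1 # w) @ ?N # b"
        using k unfolding a_b_def by (subst take_Suc_conv_app_nth) auto
      finally show "f (insert_after ((1 # w) ! k) ?N (1 # w)) = f (1 # take k w @ ?N # drop k w)"
        by (simp add: a_b_def)
    qed (use len in auto)
    also have "f (1 # w @ [?N]) + \<dots> =
        (\<Sum>k\<le>n. (if k = n then f (1 # w @ [?N]) else 0) + f (1 # take k w @ ?N # drop k w))"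
      by (simp add: sum.distrib)
    also have "\<dots> = (\<Sum>k\<le>n. 2 ^ of_bool (k = n) * f (1 # take k w @ ?N # drop k w))"
      by (intro sum.cong) (auto simp: len)
    finally show "2 ^ ?m w * (f (1 # w @ [?N]) + (\<Sum>j\<in>{1..Suc n}. f (insert_after j ?N (1 # w)))) =
      (\<Sum>k\<le>card {2..Suc n}. 2 ^ ?m (take k w @ ?N # drop k w) * f (1 # take k w @ ?N # drop k w))"
      by (simp add: sum_distrib_left min power_add mult.assoc)
  qed
  also have "\<dots> = (\<Sum>w\<in>permutations_of_set {2..?N}. 2 ^ ?m w * f (1 # w))"
    unfolding S by (rule sum_permutations_of_set_insert[symmetric]) simp_all
  finally show ?case .
qed

subsection \<open>Solving the differential equations\<close>

text \<open>The equation determines each coefficient from earlier ones. Applied to differences, this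
  gives uniqueness of solutions of initial value problems.\<close>

lemma fps_linear_ode_eq_0:
  fixes F M :: "'a::field_char_0 fps"
  assumes "fps_deriv F = M * F" "F $ 0 = 0"
  shows "F = 0"
proof -
  have "F $ n = 0" for n
  proof (induction n rule: less_induct)
    case (less n)
    show ?case
    proof (cases n)
      case (Suc m)
      have "of_nat (m + 1) * F $ (m + 1) = (M * F) $ m"
        by (metis assms(1) fps_deriv_nth Suc_eq_plus1)
      also have "\<dots> = 0"
        unfolding fps_mult_nth using less Suc by (intro sum.neutral) auto
      finally show ?thesis
        using Suc by (metis Suc_eq_plus1 mult_eq_0_iff of_nat_neq_0)
    qed (use assms in simp)
  qed
  thus ?thesis by (simp add: fps_eq_iff)
qed

text \<open>With \<open>C = cos (c x)\<close>, \<open>S = sin (c x)\<close> and primes for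
  derivatives, this is the Riccati equation for \<open>N / D\<close>, multiplied by
  \<open>D\<^sup>2\<close>. The substitution \<open>A = - v' / v\<close> linearises it to
  \<open>v'' + s\<^sup>2 v' + s\<^sup>2 v = 0\<close>, solved by a constant multiple of
  \<open>exp (- s\<^sup>2 x / 2) D\<close>; then \<open>N = s\<^sup>2 D / 2 - D'\<close>.\<close>

lemma riccati_identity:
  fixes s u c C S :: "'a::comm_ring_1"
  assumes u: "u\<^sup>2 = 4 - s\<^sup>2" and c: "2 * c = s * u" and CS: "C\<^sup>2 + S\<^sup>2 = 1"
  defines "D \<equiv> s * u * C - (2 - s\<^sup>2) * S"
    and "D' \<equiv> - c * (s * u * S + (2 - s\<^sup>2) * C)"
    and "N \<equiv> s * (u * C + s * S)"
    and "N' \<equiv> c * s * (s * C - u * S)"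
  shows "N' * D - N * D' = N\<^sup>2 - s\<^sup>2 * N * D + s\<^sup>2 * D\<^sup>2"
proof -
  have "N' * D - N * D' = (2 * c) * s * u * (C\<^sup>2 + S\<^sup>2)"
    unfolding D_def D'_def N_def N'_def by (simp add: algebra_simps power2_eq_square)
  also have "\<dots> = s\<^sup>2 * u\<^sup>2 * C\<^sup>2 + s\<^sup>2 * u\<^sup>2 * S\<^sup>2"
    unfolding c by (simp add: algebra_simps power2_eq_square)
  also have "\<dots> = s\<^sup>2 * u\<^sup>2 * C\<^sup>2 + s\<^sup>2 * (4 - s\<^sup>2) * S\<^sup>2"
    by (simp add: u)
  also have "\<dots> = N\<^sup>2 - s\<^sup>2 * N * D + s\<^sup>2 * D\<^sup>2"
    unfolding D_def N_def by (simp add: algebra_simps power2_eq_square)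
  finally show ?thesis .
qed

text \<open>Here \<open>E\<close> is \<open>exp (- s\<^sup>2 x)\<close>. The quadratic form with
  coefficients \<open>a\<close>, \<open>b\<close>, \<open>d\<close> is a particular solution of
  \<open>W' + s\<^sup>2 W = 2 s\<^sup>2 D\<^sup>2\<close>, and the multiple of \<open>E\<close>
  adjusts the initial value to \<open>(s u)\<^sup>2\<close>, that of \<open>D\<^sup>2\<close>. The
  left side is \<open>D\<^sup>3\<close> times the derivative of \<open>W / D\<^sup>2\<close>: once
  in closed form, once as the linear equation demands.\<close>

lemma linear_identity:
  fixes s u c C S E :: "'a::comm_ring_1"
  assumes u: "u\<^sup>2 = 4 - s\<^sup>2" and c: "2 * c = s * u" and CS: "C\<^sup>2 + S\<^sup>2 = 1"
  defines "D \<equiv> s * u * C - (2 - s\<^sup>2) * S"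
    and "D' \<equiv> - c * (s * u * S + (2 - s\<^sup>2) * C)"
    and "N \<equiv> s * (u * C + s * S)"
    and "a \<equiv> u\<^sup>2 * (1 + s\<^sup>2)"
    and "b \<equiv> - 2 * s * u * (1 - s\<^sup>2)"
    and "d \<equiv> 4 - 3 * s\<^sup>2 + s ^ 4"
  defines "W \<equiv> a * C\<^sup>2 + b * (S * C) + d * S\<^sup>2 - u\<^sup>2 * E"
    and "W' \<equiv> c * (2 * (d - a) * (S * C) + b * (C\<^sup>2 - S\<^sup>2)) + u\<^sup>2 * s\<^sup>2 * E"
  shows "W' * D - 2 * W * D' =
      2 * s * u\<^sup>2 * (u * C * (1 - (1 - s\<^sup>2) * E) + s * S * (1 - (3 - s\<^sup>2) * E))" (is "_ = ?R")
    and "W' * D - 2 * W * D' = 2 * (N - s\<^sup>2 * D) * W + 2 * s\<^sup>2 * D ^ 3"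
proof -
  \<comment> \<open>\<open>M\<close> is \<open>(N - s\<^sup>2 D) / s\<close> in a form free of
    division. It governs both the contribution of \<open>E\<close> and the coefficient of the linear
    equation.\<close>
  define M where "M = u * (1 - s\<^sup>2) * C + s * (3 - s\<^sup>2) * S"
  define W0 where "W0 = a * C\<^sup>2 + b * (S * C) + d * S\<^sup>2"
  define W0' where "W0' = c * (2 * (d - a) * (S * C) + b * (C\<^sup>2 - S\<^sup>2))"
  have M: "N - s\<^sup>2 * D = s * M"
    unfolding N_def D_def M_def by (simp add: algebra_simps power2_eq_square)
  have "s\<^sup>2 * D + 2 * D' = s\<^sup>2 * D - (2 * c) * (s * u * S + (2 - s\<^sup>2) * C)"
    unfolding D'_def by (simp add: algebra_simps)
  also have "\<dots> = s\<^sup>2 * D - s\<^sup>2 * u\<^sup>2 * S - (2 - s\<^sup>2) * s * u * C"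
    unfolding c by (simp add: algebra_simps power2_eq_square)
  also have "\<dots> = - 2 * s * M"
    unfolding u D_def M_def by (simp add: algebra_simps power2_eq_square)
  finally have E: "s\<^sup>2 * D + 2 * D' = - 2 * s * M" .

  have "W0' * D - 2 * W0 * D' =
      c * (C\<^sup>2 + S\<^sup>2) * ((b * (s * u) + 2 * a * (2 - s\<^sup>2)) * C + (2 * d * (s * u) + b * (2 - s\<^sup>2)) * S)"
    unfolding W0_def W0'_def D_def D'_def by (simp add: algebra_simps power2_eq_square)
  also have "b * (s * u) + 2 * a * (2 - s\<^sup>2) = 4 * u\<^sup>2"
    unfolding a_def b_def by (simp add: algebra_simps power2_eq_square)
  also have "2 * d * (s * u) + b * (2 - s\<^sup>2) = 4 * s * u"
    unfolding d_def b_def by (simp add: algebra_simps power2_eq_square power4_eq_xxxx)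
  also have "c * (C\<^sup>2 + S\<^sup>2) * (4 * u\<^sup>2 * C + 4 * s * u * S) = 2 * c * (2 * u * (u * C + s * S))"
    unfolding CS by (simp add: algebra_simps power2_eq_square)
  also have "\<dots> = 2 * s * u\<^sup>2 * (u * C + s * S)"
    unfolding c by (simp add: algebra_simps power2_eq_square)
  finally have W0: "W0' * D - 2 * W0 * D' = 2 * s * u\<^sup>2 * (u * C + s * S)" .

  have W: "W = W0 - u\<^sup>2 * E" "W' = W0' + u\<^sup>2 * s\<^sup>2 * E"
    by (simp_all add: W_def W'_def W0_def W0'_def)
  have "W' * D - 2 * W * D' = (W0' * D - 2 * W0 * D') + u\<^sup>2 * E * (s\<^sup>2 * D + 2 * D')"
    unfolding W by (simp add: algebra_simps)
  also have eq: "\<dots> = 2 * s * u\<^sup>2 * (u * C + s * S - M * E)"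
    unfolding W0 E by (simp add: algebra_simps)
  also have "\<dots> = ?R"
    unfolding M_def by (simp add: algebra_simps)
  finally show main: "W' * D - 2 * W * D' = ?R" .

  \<comment> \<open>The second identity reduces to this comparison of cubic forms in
    \<open>C\<close> and \<open>S\<close>, where \<open>u\<^sup>2 = 4 - s\<^sup>2\<close> lets
    \<open>C\<^sup>2 + S\<^sup>2\<close> split off.\<close>
  have "M * W0 + s * D ^ 3 = u ^ 3 * C ^ 3 + u\<^sup>2 * s * C\<^sup>2 * S
      + u * (4 - s\<^sup>2) * C * S\<^sup>2 + s * (4 - s\<^sup>2) * S ^ 3"
    unfolding M_def W0_def D_def a_def b_def d_def
    by (simp add: algebra_simps power2_eq_square power3_eq_cube power4_eq_xxxx)
  also have "\<dots> = u\<^sup>2 * (u * C + s * S) * (C\<^sup>2 + S\<^sup>2)"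
    unfolding u[symmetric] by (simp add: algebra_simps power2_eq_square power3_eq_cube)
  finally have "M * W0 + s * D ^ 3 = u\<^sup>2 * (u * C + s * S)"
    by (simp add: CS)
  then have "2 * s * u\<^sup>2 * (u * C + s * S - M * E) = 2 * s * (M * W0 + s * D ^ 3 - u\<^sup>2 * M * E)"
    by (simp add: algebra_simps)
  also have "\<dots> = 2 * (N - s\<^sup>2 * D) * W + 2 * s\<^sup>2 * D ^ 3"
    unfolding M W by (simp add: algebra_simps power2_eq_square)
  finally show "W' * D - 2 * W * D' = 2 * (N - s\<^sup>2 * D) * W + 2 * s\<^sup>2 * D ^ 3"
    unfolding main M_def by (simp add: algebra_simps)
qed

section \<open>Half-angle substitution\<close>

lemma fps_tan_half_angle:
  fixes h :: "'a::field_char_0"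
  defines "t \<equiv> fps_tan h"
  shows "(1 + t\<^sup>2) * fps_cos (2 * h) = 1 - t\<^sup>2"
    and "(1 + t\<^sup>2) * fps_sin (2 * h) = 2 * t"
    and "(1 + t\<^sup>2) * (fps_cos h)\<^sup>2 = 1"
proof -
  have t: "t * fps_cos h = fps_sin h"
    unfolding t_def fps_tan_def by (simp add: fps_divide_unit mult.assoc inverse_mult_eq_1)
  have C: "fps_cos (2 * h) = (fps_cos h)\<^sup>2 - (t * fps_cos h)\<^sup>2"
    unfolding t mult_2 fps_cos_add by (simp add: power2_eq_square)
  have S: "fps_sin (2 * h) = 2 * (t * fps_cos h) * fps_cos h"
    unfolding t mult_2 fps_sin_add by (simp add: algebra_simps)
  \<comment> \<open>This makes \<open>1 + t\<^sup>2\<close> the inverse of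
    \<open>(fps_cos h)\<^sup>2\<close>, so the double-angle formulas need no division.\<close>
  have "(1 + t\<^sup>2) * (fps_cos h)\<^sup>2 = (fps_cos h)\<^sup>2 + (t * fps_cos h)\<^sup>2"
    by (simp add: algebra_simps power_mult_distrib)
  also have "\<dots> = 1"
    unfolding t by (rule fps_sin_cos_sum_of_squares)
  finally show K: "(1 + t\<^sup>2) * (fps_cos h)\<^sup>2 = 1" .
  have "(1 + t\<^sup>2) * fps_cos (2 * h) = ((1 + t\<^sup>2) * (fps_cos h)\<^sup>2) * (1 - t\<^sup>2)"
    unfolding C by (simp add: algebra_simps power_mult_distrib)
  then show "(1 + t\<^sup>2) * fps_cos (2 * h) = 1 - t\<^sup>2"
    unfolding K by simp
  have "(1 + t\<^sup>2) * fps_sin (2 * h) = ((1 + t\<^sup>2) * (fps_cos h)\<^sup>2) * (2 * t)"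
    unfolding S by (simp add: algebra_simps power2_eq_square)
  then show "(1 + t\<^sup>2) * fps_sin (2 * h) = 2 * t"
    unfolding K by simp
qed

text \<open>Passing from sine and cosine to \<open>t\<close> costs one factor
  \<open>1 + t\<^sup>2\<close> per linear form. Numerator and denominator both collect its cube,
  which cancels. \<open>M\<close> and \<open>N\<close> are arbitrary, so the exponentials need not
  be touched.\<close>

lemma fps_tan_substitution:
  fixes s u h :: "'a::field_char_0" and M N :: "'a fps"
  assumes u: "u\<^sup>2 = 4 - s\<^sup>2" and nz: "s \<noteq> 0" "u \<noteq> 0"
  defines "t \<equiv> fps_tan h" and "s' \<equiv> fps_const s" and "u' \<equiv> fps_const u"
  assumes R: "R * (s' * u' * fps_cos (2 * h) - (2 - s'\<^sup>2) * fps_sin (2 * h)) ^ 3 =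
     2 * s' * u'\<^sup>2 * (u' * fps_cos (2 * h) * M + s' * fps_sin (2 * h) * N)"
  shows "2 * s' * u'\<^sup>2 * (1 + t\<^sup>2)\<^sup>2 * ((1 - t\<^sup>2) * u' * M + 2 * s' * t * N)
     / ((s' * t + u') ^ 3 * (s' - u' * t) ^ 3) = R"
proof -
  define K where "K = 1 + t\<^sup>2"
  have K: "1 - t\<^sup>2 = K * fps_cos (2 * h)" "2 * t = K * fps_sin (2 * h)"
    using fps_tan_half_angle[of h] by (simp_all add: K_def t_def)
  have u': "u'\<^sup>2 = 4 - s'\<^sup>2"
    unfolding u'_def s'_def fps_const_power u fps_const_sub[symmetric]
    by (simp flip: fps_numeral_fps_const)
  have "(s' * t + u') * (s' - u' * t) = s' * u' * (1 - t\<^sup>2) + (s'\<^sup>2 - u'\<^sup>2) * t"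
    by (simp add: algebra_simps power2_eq_square)
  also have "\<dots> = s' * u' * (1 - t\<^sup>2) - (2 - s'\<^sup>2) * (2 * t)"
    unfolding u' by (simp add: algebra_simps)
  also have "\<dots> = K * (s' * u' * fps_cos (2 * h) - (2 - s'\<^sup>2) * fps_sin (2 * h))"
    unfolding K by (simp add: algebra_simps)
  finally have P: "(s' * t + u') ^ 3 * (s' - u' * t) ^ 3
      = K ^ 3 * (s' * u' * fps_cos (2 * h) - (2 - s'\<^sup>2) * fps_sin (2 * h)) ^ 3"
    by (simp flip: power_mult_distrib)
  have "2 * s' * u'\<^sup>2 * (1 + t\<^sup>2)\<^sup>2 * ((1 - t\<^sup>2) * u' * M + 2 * s' * t * N)
      = 2 * s' * u'\<^sup>2 * K\<^sup>2 * ((1 - t\<^sup>2) * u' * M + s' * (2 * t) * N)"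
    by (simp add: K_def algebra_simps)
  also have "\<dots> = K ^ 3 * (2 * s' * u'\<^sup>2 * (u' * fps_cos (2 * h) * M + s' * fps_sin (2 * h) * N))"
    unfolding K by (simp add: algebra_simps power2_eq_square power3_eq_cube)
  also have "\<dots> = R * ((s' * t + u') ^ 3 * (s' - u' * t) ^ 3)"
    unfolding R[symmetric] P by (simp add: algebra_simps)
  finally have eq: "2 * s' * u'\<^sup>2 * (1 + t\<^sup>2)\<^sup>2 * ((1 - t\<^sup>2) * u' * M + 2 * s' * t * N)
      = R * ((s' * t + u') ^ 3 * (s' - u' * t) ^ 3)" .
  \<comment> \<open>The constant term is \<open>(u s)^3\<close>, since \<open>t\<close> has none;
    this justifies the cancellation.\<close>
  have "((s' * t + u') ^ 3 * (s' - u' * t) ^ 3) $ 0 \<noteq> 0"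
    using nz by (simp add: fps_nth_power_0 s'_def u'_def t_def fps_tan_def fps_divide_unit)
  then have "(s' * t + u') ^ 3 * (s' - u' * t) ^ 3 \<noteq> 0"
    by (metis fps_zero_nth)
  then show ?thesis
    unfolding eq by (rule nonzero_mult_div_cancel_right)
qed

text \<open>To be used with \<open>A\<close> and \<open>G\<close> the series for
  \<open>y = 1\<close> and \<open>y = 2\<close>. The conclusion concerns the derivative of
  \<open>G\<close>, which is what the integrand is compared with, and is cleared of
  denominators.\<close>

lemma ode_solution:
  fixes s u c :: "'a::field_char_0" and A G :: "'a fps"
  assumes u: "u\<^sup>2 = 4 - s\<^sup>2" and nz: "s \<noteq> 0" "u \<noteq> 0" and c: "2 * c = s * u"
  assumes A: "fps_deriv A = A\<^sup>2 - fps_const (s\<^sup>2) * A + fps_const (s\<^sup>2)" "A $ 0 = 1"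
  assumes G: "fps_deriv G = 2 * ((A - fps_const (s\<^sup>2)) * G + fps_const (s\<^sup>2))" "G $ 0 = 1"
  defines "s' \<equiv> fps_const s" and "u' \<equiv> fps_const u"
  shows "fps_deriv G * (s' * u' * fps_cos c - (2 - s'\<^sup>2) * fps_sin c) ^ 3 =
     2 * s' * u'\<^sup>2 * (u' * fps_cos c * (1 - fps_const (1 - s\<^sup>2) * fps_exp (- s\<^sup>2))
       + s' * fps_sin c * (1 - fps_const (3 - s\<^sup>2) * fps_exp (- s\<^sup>2)))"
proof -
  define c' C S E where "c' = fps_const c" "C = fps_cos c" "S = fps_sin c" "E = fps_exp (- s\<^sup>2)"
  note defs = s'_def u'_def c'_C_S_E_def
  have deriv: "fps_deriv s' = 0" "fps_deriv u' = 0" "fps_deriv C = - c' * S" "fps_deriv S = c' * C"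
      "fps_deriv E = - s'\<^sup>2 * E"
    by (simp_all add: defs fps_cos_deriv fps_sin_deriv flip: fps_const_neg)
  have init: "C $ 0 = 1" "S $ 0 = 0" "E $ 0 = 1"
    by (simp_all add: defs)
  have u': "u'\<^sup>2 = 4 - s'\<^sup>2"
    unfolding u'_def s'_def fps_const_power u fps_const_sub[symmetric]
    by (simp flip: fps_numeral_fps_const)
  have c': "2 * c' = s' * u'"
    unfolding defs fps_const_mult c[symmetric] by (simp add: numeral_fps_const)
  have CS: "C\<^sup>2 + S\<^sup>2 = 1"
    unfolding defs by (rule fps_sin_cos_sum_of_squares)
  have const: "fps_const (s\<^sup>2) = s'\<^sup>2" "fps_const (1 - s\<^sup>2) = 1 - s'\<^sup>2" "fps_const (3 - s\<^sup>2) = 3 - s'\<^sup>2"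
    by (simp_all add: s'_def numeral_fps_const fps_const_power flip: fps_const_sub)
  note A' = A(1)[unfolded const] and G' = G(1)[unfolded const]

  txt \<open>
    The Riccati solution is \<open>A = N / D\<close>. Since \<open>2 (A - s\<^sup>2) = - s\<^sup>2 - 2 D' / D\<close>, the product
    \<open>D\<^sup>2 exp (s\<^sup>2 x)\<close> is an integrating factor of the linear equation, and
    \<open>W = D\<^sup>2 G\<close> comes from integrating \<open>2 s\<^sup>2 D\<^sup>2 exp (s\<^sup>2 x)\<close>.
  \<close>
  define D N where "D = s' * u' * C - (2 - s'\<^sup>2) * S" "N = s' * (u' * C + s' * S)"
  define a b d where "a = u'\<^sup>2 * (1 + s'\<^sup>2)" "b = - 2 * s' * u' * (1 - s'\<^sup>2)" "d = 4 - 3 * s'\<^sup>2 + s' ^ 4"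
  define W where "W = a * C\<^sup>2 + b * (S * C) + d * S\<^sup>2 - u'\<^sup>2 * E"
  have D': "fps_deriv D = - c' * (s' * u' * S + (2 - s'\<^sup>2) * C)"
    by (simp add: D_N_def deriv fps_deriv_power algebra_simps)
  have N': "fps_deriv N = c' * s' * (s' * C - u' * S)"
    by (simp add: D_N_def deriv algebra_simps)
  have abd: "fps_deriv a = 0" "fps_deriv b = 0" "fps_deriv d = 0"
    by (simp_all add: a_b_d_def deriv fps_deriv_power)
  have W': "fps_deriv W = c' * (2 * (d - a) * (S * C) + b * (C\<^sup>2 - S\<^sup>2)) + u'\<^sup>2 * s'\<^sup>2 * E"
    by (simp add: W_def abd deriv fps_deriv_power algebra_simps power2_eq_square)
  \<comment> \<open>These values give both quotients \<open>N / D\<close> and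
    \<open>W / D\<^sup>2\<close> the constant term 1 of the initial conditions.\<close>
  have D0: "D $ 0 = s * u" and N0: "N $ 0 = s * u" and W0: "W $ 0 = (s * u)\<^sup>2"
    by (simp_all add: D_N_def W_def a_b_d_def init fps_nth_power_0 fps_mult_nth_0)
       (simp_all add: s'_def u'_def power2_eq_square algebra_simps)
  have Dunit: "D $ 0 \<noteq> 0" using D0 nz by simp
  then have Dnz: "D \<noteq> 0" by auto

  define A1 R where "A1 = N * inverse D" "R = W * inverse (D\<^sup>2)"
  have A1: "A1 * D = N"
    using Dunit by (simp add: A1_R_def mult.assoc inverse_mult_eq_1)
  have R: "R * D\<^sup>2 = W"
    using Dunit by (simp add: A1_R_def mult.assoc inverse_mult_eq_1 fps_nth_power_0)
  have A1_0: "A1 $ 0 = 1" and R0: "R $ 0 = 1"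
    using A1 R D0 N0 W0 nz by (metis fps_mult_nth_0 mult_cancel_right2 no_zero_divisors fps_nth_power_0 power_eq_0_iff)+

  have A1': "fps_deriv A1 = A1\<^sup>2 - s'\<^sup>2 * A1 + s'\<^sup>2"
  proof -
    have "fps_deriv N = fps_deriv A1 * D + A1 * fps_deriv D"
      by (simp flip: A1)
    then have "fps_deriv A1 * D\<^sup>2 = fps_deriv N * D - (A1 * D) * fps_deriv D"
      by (simp add: algebra_simps power2_eq_square)
    also have "\<dots> = fps_deriv N * D - N * fps_deriv D"
      by (simp add: A1)
    also have "\<dots> = N\<^sup>2 - s'\<^sup>2 * N * D + s'\<^sup>2 * D\<^sup>2"
      unfolding N' D' unfolding D_N_def by (rule riccati_identity[OF u' c' CS])
    also have "\<dots> = (A1\<^sup>2 - s'\<^sup>2 * A1 + s'\<^sup>2) * D\<^sup>2"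
      unfolding A1[symmetric] by (simp add: algebra_simps power2_eq_square)
    finally show ?thesis using Dnz by simp
  qed
  have "A - A1 = 0"
  proof (rule fps_linear_ode_eq_0)
    \<comment> \<open>Subtracting two Riccati equations leaves a linear one, since the difference of
      squares factors.\<close>
    show "fps_deriv (A - A1) = (A + A1 - s'\<^sup>2) * (A - A1)"
      by (simp add: A' A1' algebra_simps power2_eq_square)
  qed (simp add: A A1_0)
  then have A_eq: "A = A1" by simp

  have "fps_deriv W = fps_deriv R * D\<^sup>2 + R * (2 * D * fps_deriv D)"
    by (simp add: fps_deriv_power power2_eq_square algebra_simps flip: R)
  then have "fps_deriv R * D ^ 3 = fps_deriv W * D - 2 * (R * D\<^sup>2) * fps_deriv D"
    by (simp add: algebra_simps power2_eq_square power3_eq_cube)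
  then have R3: "fps_deriv R * D ^ 3 = fps_deriv W * D - 2 * W * fps_deriv D"
    by (simp add: R)
  also have "\<dots> = 2 * (N - s'\<^sup>2 * D) * W + 2 * s'\<^sup>2 * D ^ 3"
    unfolding W' D' unfolding D_N_def W_def a_b_d_def by (rule linear_identity(2)[OF u' c' CS])
  also have "\<dots> = (2 * ((A - s'\<^sup>2) * R + s'\<^sup>2)) * D ^ 3"
    unfolding R[symmetric] A1[symmetric] A_eq by (simp add: algebra_simps power2_eq_square power3_eq_cube)
  finally have R': "fps_deriv R = 2 * ((A - s'\<^sup>2) * R + s'\<^sup>2)"
    using Dnz by simp
  have "G - R = 0"
  proof (rule fps_linear_ode_eq_0)
    show "fps_deriv (G - R) = (2 * (A - s'\<^sup>2)) * (G - R)"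
      by (simp add: G' R' algebra_simps)
  qed (simp add: G R0)
  then have "fps_deriv G * D ^ 3 = fps_deriv W * D - 2 * W * fps_deriv D"
    using R3 by simp
  also have "\<dots> = 2 * s' * u'\<^sup>2 * (u' * C * (1 - (1 - s'\<^sup>2) * E) + s' * S * (1 - (3 - s'\<^sup>2) * E))"
    unfolding W' D' unfolding D_N_def W_def a_b_d_def by (rule linear_identity(1)[OF u' c' CS])
  finally show ?thesis
    unfolding const D_N_def c'_C_S_E_def .
qed

subsection \<open>The generating function\<close>

lemma embed_simps [simp]:
  "embed 0 = 0" "embed 1 = 1" "embed (f + g) = embed f + embed g" "embed (f * g) = embed f * embed g"
  by (simp_all add: embed_def flip: Zero_fract_def One_fract_def to_ac_add to_ac_mult)

lemma embed_power [simp]: "embed (f ^ n) = embed f ^ n"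
  by (induction n) simp_all

lemma embed_sum [simp]: "embed (\<Sum>x\<in>A. h x) = (\<Sum>x\<in>A. embed (h x))"
  by (induction A rule: infinite_finite_induct) simp_all

lemma embed_numeral [simp]: "embed (numeral n) = numeral n"
  by (induction n rule: num_induct) (simp_all only: numeral_One numeral_inc embed_simps)

lemma embed_eq_iff [simp]: "embed f = embed g \<longleftrightarrow> f = g"
  by (simp add: embed_def eq_fract)

text \<open>The two elements are images of the nonzero polynomials \<open>1 - q\<close> and
  \<open>3 + q\<close> under an injective map.\<close>

lemma theta_nonzero: "\<theta> \<noteq> 0" "4 - \<theta> \<noteq> 0"
proof -
  have "embed 1 \<noteq> embed [:0, 1:]" "embed ([:0, 1:] + 3) \<noteq> embed 0"
    unfolding embed_eq_iff by (simp_all add: numeral_poly one_pCons)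
  then show "\<theta> \<noteq> 0" "4 - \<theta> \<noteq> 0"
    by (simp_all add: \<theta>_def add.commute)
qed

text \<open>Setting \<open>y = 2\<close> turns the multiplicity of each word into its weight by
  right-to-left minima; the letters \<open>2, ..., n + 1\<close> all exceed the leading 1.\<close>

lemma embed_g_r: "embed (g_r (Suc n)) = standard_weight (embed [:0, 1:]) 2 n"
proof -
  let ?q = "[:0, 1:] :: int poly" and ?P = "permutations_of_set {2..Suc n}"
  have "g_r (Suc n) = (\<Sum>w\<in>?P. 2 ^ right_to_left_minima w * ?q ^ num_123 (1 # w))"
    unfolding g_r_def by (rule sum_flatten_eq_sum_words)
  also have "\<dots> = (\<Sum>w\<in>?P. 2 ^ right_to_left_minima w * ?q ^ num_123_prefixed w)"
  proof (rule sum.cong)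
    fix w assume "w \<in> ?P"
    then have "\<forall>x\<in>set w. 1 < x" by (auto simp: permutations_of_set_def)
    then show "2 ^ right_to_left_minima w * ?q ^ num_123 (1 # w)
        = 2 ^ right_to_left_minima w * ?q ^ num_123_prefixed w"
      by (simp only: num_123_Cons_min)
  qed simp
  also have "embed \<dots> = total_weight (embed ?q) 2 {2..Suc n}"
    by (simp add: total_weight_def word_weight_def mult.commute)
  also have "\<dots> = standard_weight (embed ?q) 2 n"
    using total_weight_eq_standard_weight[of "{2..Suc n}" "embed ?q" 2] by simp
  finally show ?thesis .
qed

theorem theorem3p5:
  fixes s u :: K
  assumes "s\<^sup>2 = \<theta>" and "u\<^sup>2 = 4 - \<theta>"
  shows "G_r = 1 + fps_integral0 (H_r s u)"
proof -
  let ?q = "embed [:0, 1:]"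
  have u: "u\<^sup>2 = 4 - s\<^sup>2" and nz: "s \<noteq> 0" "u \<noteq> 0"
    using assms theta_nonzero by auto
  have q: "1 - ?q = s\<^sup>2"
    using assms(1) by (simp add: \<theta>_def)
  have G: "G_r = weight_egf ?q 2"
    by (simp add: G_r_def weight_egf_def embed_g_r)
  \<comment> \<open>\<open>h\<close> is the frequency inside \<xi>; the differential equations are
    solved with twice this frequency.\<close>
  define h where "h = s * u / 4"
  have h: "2 * (2 * h) = s * u"
    by (simp add: h_def)
  have A: "fps_deriv (weight_egf ?q 1) =
      (weight_egf ?q 1)\<^sup>2 - fps_const (s\<^sup>2) * weight_egf ?q 1 + fps_const (s\<^sup>2)"
    unfolding weight_egf_deriv q by (simp add: algebra_simps power2_eq_square)
  have G': "fps_deriv G_r = 2 * ((weight_egf ?q 1 - fps_const (s\<^sup>2)) * G_r + fps_const (s\<^sup>2))"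
    unfolding G weight_egf_deriv q by (simp add: numeral_fps_const)
  have "G_r $ 0 = 1"
    unfolding G by simp
  note sol = ode_solution[OF u nz h A weight_egf_0 G' this]
  \<comment> \<open>The constants of \<open>H_r\<close> are rewritten with
    \<open>4 - s\<^sup>2 = u\<^sup>2\<close> to match the form of the half-angle
    substitution.\<close>
  have coeffs: "fps_const (2 * s * (4 - s\<^sup>2)) = 2 * fps_const s * (fps_const u)\<^sup>2"
    "fps_const (2 * s) = 2 * fps_const s"
    by (simp_all add: numeral_fps_const fps_const_power flip: u)
  have "fps_deriv G_r = H_r s u"
    unfolding H_r_def Let_def \<xi>_def h_def[symmetric] assms(1)[symmetric] coeffs
    by (rule fps_tan_substitution[OF u nz sol, symmetric])
  then have "fps_integral0 (H_r s u) = G_r - fps_const (G_r $ 0)"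
    by (metis fps_integral0_deriv)
  then show ?thesis
    unfolding G by simp
qed

end
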